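(* Let $T\in\mathbb{N}$, $p\in[1,\infty)$, $\epsilon\ge 0$ and $\rho\ge 0$. The optimization problem \[ \max_{w\in\mathcal{W}_T}\ N_{\mathrm{eff}}(w)\,\bigl(\epsilon-D_p(w)\rho\bigr)_+^{2p} \] admits an optimal solution of the form \[ w_t=\bigl(a_1-a_2(T-t+1)^p\bigr)_+,\qquad t\in\{1,\ldots,T\}, \] for some constants $a_1,a_2\ge 0$.
   Context: $x_+=\max\{0,x\}$. $\mathcal{W}_T=\{w\in\mathbb{R}^T: w_t\ge 0,\ \sum_{t=1}^T w_t=1\}$. $N_{\mathrm{eff}}(w)=1/\sum_{t=1}^T w_t^2$ and $D_p(w)=\bigl(\sum_{t=1}^T w_t(T-t+1)^p\bigr)^{1/p}$. *)

theory Defs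
  imports Complex_Main "HOL-Library.FuncSet"
begin

(* A vector of R^T is an extensional function on the index set {1..T}. *)
definition weight_simplex :: "nat \<Rightarrow> (nat \<Rightarrow> real) set" where
  "weight_simplex T = {w \<in> {1..T} \<rightarrow>\<^sub>E UNIV. (\<forall>t\<in>{1..T}. 0 \<le> w t) \<and> (\<Sum>t=1..T. w t) = 1}"

definition N_eff :: "nat \<Rightarrow> (nat \<Rightarrow> real) \<Rightarrow> real" where
  "N_eff T w = 1 / (\<Sum>t=1..T. (w t)\<^sup>2)"

definition D_p :: "nat \<Rightarrow> real \<Rightarrow> (nat \<Rightarrow> real) \<Rightarrow> real" where
  "D_p T p w = (\<Sum>t=1..T. w t * real (T - t + 1) powr p) powr (1 / p)"

definition pos_part :: "real \<Rightarrow> real" where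
  "pos_part x = max 0 x"

definition objective :: "nat \<Rightarrow> real \<Rightarrow> real \<Rightarrow> real \<Rightarrow> (nat \<Rightarrow> real) \<Rightarrow> real" where
  "objective T p \<epsilon> \<rho> w = N_eff T w * pos_part (\<epsilon> - D_p T p w * \<rho>) powr (2 * p)"

end

theory Submission
  imports Defs
begin

text \<open>
  Write \<open>c\<^sub>t = (T - t + 1)\<^sup>p\<close>. The objective depends on \<open>w\<close> only through \<open>\<Sum>w\<^sub>t\<^sup>2\<close> and the
  moment \<open>\<Sum>w\<^sub>t c\<^sub>t\<close>, and is nonincreasing in both. For \<open>\<mu>\<close> in \<open>[0, 1/2]\<close> consider the weights
  proportional to \<open>(1 - \<mu> c\<^sub>t)\<^sub>+\<close>. They run continuously from the uniform weights at \<open>\<mu> = 0\<close> to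
  the unit mass at \<open>t = T\<close> at \<open>\<mu> = 1/2\<close> (because \<open>c\<^sub>t \<ge> 2\<close> for \<open>t < T\<close>), which has the smallest
  moment, namely \<open>1\<close>. By the intermediate value theorem every \<open>v\<close> in the simplex whose moment does
  not exceed the uniform one shares its moment with a member of the family, and the complementarity
  argument for projections shows that this member has the smaller sum of squares; the other \<open>v\<close>
  are dominated by the uniform weights. So it suffices to maximize a continuous function of \<open>\<mu>\<close>
  over \<open>[0, 1/2]\<close>.
\<close>

definition moment :: "nat \<Rightarrow> real \<Rightarrow> (nat \<Rightarrow> real) \<Rightarrow> real" where
  "moment T p w = (\<Sum>t=1..T. w t * real (T - t + 1) powr p)"

definition hinge_sum :: "nat \<Rightarrow> real \<Rightarrow> real \<Rightarrow> real" where
  "hinge_sum T p \<mu> = (\<Sum>t=1..T. pos_part (1 - \<mu> * real (T - t + 1) powr p))"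

definition hinge_weight :: "nat \<Rightarrow> real \<Rightarrow> real \<Rightarrow> nat \<Rightarrow> real" where
  "hinge_weight T p \<mu> =
    (\<lambda>t\<in>{1..T}. pos_part (1 - \<mu> * real (T - t + 1) powr p) / hinge_sum T p \<mu>)"

lemma pos_part_nonneg [simp]: "0 \<le> pos_part x"
  by (simp add: pos_part_def)

lemma pos_part_mono: "x \<le> y \<Longrightarrow> pos_part x \<le> pos_part y"
  by (simp add: pos_part_def)

lemma continuous_on_pos_part [continuous_intros]:
  "continuous_on S f \<Longrightarrow> continuous_on S (\<lambda>x. pos_part (f x))"
  unfolding pos_part_def by (intro continuous_intros)

lemma pos_part_divide: "0 < k \<Longrightarrow> pos_part x / k = pos_part (x / k)"
  by (auto simp: pos_part_def max_def field_simps)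

text \<open>The summand at \<open>t = T\<close> has coefficient 1, so it is
  \<open>1 - \<mu>\<close>, at least 1/2. This is what allows normalizing up to
  \<open>\<mu> = 1/2\<close>.\<close>

lemma hinge_sum_pos:
  assumes "1 \<le> T" "\<mu> \<le> 1/2"
  shows "0 < hinge_sum T p \<mu>"
proof -
  have "pos_part (1 - \<mu> * real (T - T + 1) powr p) \<le> hinge_sum T p \<mu>"
    unfolding hinge_sum_def by (rule member_le_sum) (use assms in auto)
  moreover have "0 < pos_part (1 - \<mu> * real (T - T + 1) powr p)"
    using assms by (simp add: pos_part_def)
  ultimately show ?thesis by linarith
qed

lemma hinge_weight_in_simplex:
  assumes "1 \<le> T" "\<mu> \<le> 1/2"
  shows "hinge_weight T p \<mu> \<in> weight_simplex T"
proof -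
  note pos = hinge_sum_pos[OF assms, of p]
  have "(\<Sum>t=1..T. hinge_weight T p \<mu> t) = hinge_sum T p \<mu> / hinge_sum T p \<mu>"
    unfolding hinge_sum_def[of T p \<mu>] sum_divide_distrib
    by (intro sum.cong) (simp_all add: hinge_weight_def hinge_sum_def)
  then show ?thesis
    using pos by (auto simp: weight_simplex_def hinge_weight_def)
qed

text \<open>Division by the positive normalizer passes through \<open>pos_part\<close>, which gives
  the form the theorem asks for.\<close>

lemma hinge_weight_eq_pos_part:
  assumes "1 \<le> T" "\<mu> \<le> 1/2" "t \<in> {1..T}"
  shows "hinge_weight T p \<mu> t =
    pos_part (1 / hinge_sum T p \<mu> - \<mu> / hinge_sum T p \<mu> * real (T - t + 1) powr p)"
  using assms hinge_sum_pos[OF assms(1,2), of p]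
  by (simp add: hinge_weight_def pos_part_divide diff_divide_distrib)

text \<open>Keeps \<open>N_eff\<close> away from the default value of division by zero: vanishing
  squares would contradict total mass 1.\<close>

lemma sum_squares_pos:
  assumes "w \<in> weight_simplex T"
  shows "0 < (\<Sum>t=1..T. (w t)\<^sup>2)"
proof (rule ccontr)
  assume "\<not> ?thesis"
  then have "(\<Sum>t=1..T. (w t)\<^sup>2) = 0"
    by (meson linorder_not_less order_antisym sum_nonneg zero_le_power2)
  then have "\<forall>t\<in>{1..T}. w t = 0"
    by (subst (asm) sum_nonneg_eq_0_iff) auto
  then show False
    using assms by (simp add: weight_simplex_def)
qed

lemma continuous_on_hinge_weight:
  assumes "1 \<le> T"
  shows "continuous_on {0..1/2} (\<lambda>\<mu>. hinge_weight T p \<mu> t)"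
proof (cases "t \<in> {1..T}")
  case True
  have "continuous_on {0..1/2} (hinge_sum T p)"
    unfolding hinge_sum_def by (intro continuous_intros)
  moreover have "\<forall>\<mu>\<in>{0..1/2}. hinge_sum T p \<mu> \<noteq> 0"
    using hinge_sum_pos[OF assms] by (auto intro!: less_imp_neq[THEN not_sym])
  ultimately have "continuous_on {0..1/2}
      (\<lambda>\<mu>. pos_part (1 - \<mu> * real (T - t + 1) powr p) / hinge_sum T p \<mu>)"
    by (intro continuous_intros) auto
  with True show ?thesis by (simp add: hinge_weight_def)
next
  case False
  then show ?thesis by (simp add: hinge_weight_def restrict_def del: atLeastAtMost_iff)
qed

lemma continuous_on_moment_hinge_weight:
  assumes "1 \<le> T"
  shows "continuous_on {0..1/2} (\<lambda>\<mu>. moment T p (hinge_weight T p \<mu>))"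
  unfolding moment_def by (intro continuous_intros continuous_on_hinge_weight assms)

lemma moment_nonneg: "w \<in> weight_simplex T \<Longrightarrow> 0 \<le> moment T p w"
  unfolding moment_def by (intro sum_nonneg) (auto simp: weight_simplex_def)

lemma D_p_eq_moment: "D_p T p w = moment T p w powr (1 / p)"
  by (simp add: D_p_def moment_def)

lemma continuous_on_objective_hinge_weight:
  assumes "1 \<le> T" "1 \<le> p"
  shows "continuous_on {0..1/2} (\<lambda>\<mu>. objective T p \<epsilon> \<rho> (hinge_weight T p \<mu>))"
proof -
  have "(\<Sum>t=1..T. (hinge_weight T p \<mu> t)\<^sup>2) \<noteq> 0" if "\<mu> \<in> {0..1/2}" for \<mu>
    using sum_squares_pos[OF hinge_weight_in_simplex, of T \<mu> p] assms that by simp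
  then have squares: "continuous_on {0..1/2} (\<lambda>\<mu>. N_eff T (hinge_weight T p \<mu>))"
    unfolding N_eff_def
    by (intro continuous_intros continuous_on_hinge_weight assms ballI)
  have D: "continuous_on {0..1/2} (\<lambda>\<mu>. D_p T p (hinge_weight T p \<mu>))"
    unfolding D_p_eq_moment
    by (rule continuous_on_powr'[OF continuous_on_moment_hinge_weight continuous_on_const])
      (use assms in \<open>auto intro!: moment_nonneg hinge_weight_in_simplex\<close>)
  \<comment> \<open>The base may reach 0; \<open>powr\<close> stays continuous there because the
    exponent \<open>2 * p\<close> is positive.\<close>
  have "continuous_on {0..1/2} (\<lambda>\<mu>. pos_part (\<epsilon> - D_p T p (hinge_weight T p \<mu>) * \<rho>) powr (2 * p))"
    by (rule continuous_on_powr') (use assms D in \<open>auto intro!: continuous_intros\<close>)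
  with squares show ?thesis
    unfolding objective_def by (rule continuous_on_mult)
qed

lemma moment_ge_1:
  assumes "0 \<le> p" "w \<in> weight_simplex T"
  shows "1 \<le> moment T p w"
proof -
  have "(\<Sum>t=1..T. w t * 1) \<le> moment T p w"
    unfolding moment_def
    by (intro sum_mono mult_left_mono)
      (use assms in \<open>auto simp: weight_simplex_def intro!: ge_one_powr_ge_zero\<close>)
  with assms show ?thesis by (simp add: weight_simplex_def)
qed

lemma moment_hinge_weight_half:
  assumes "1 \<le> T" "1 \<le> p"
  shows "moment T p (hinge_weight T p (1/2)) = 1"
proof -
  let ?w = "hinge_weight T p (1/2)"
  have mem: "?w \<in> weight_simplex T"
    using assms by (intro hinge_weight_in_simplex) auto
  have zero: "?w t = 0" if "t \<in> {1..T} - {T}" for t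
  proof -
    have "2 \<le> real (T - t + 1)" using that by auto
    moreover have "real (T - t + 1) powr 1 \<le> real (T - t + 1) powr p"
      using assms that by (intro powr_mono) auto
    ultimately have "2 \<le> real (T - t + 1) powr p" by simp
    then show ?thesis using that by (simp add: hinge_weight_def pos_part_def)
  qed
  \<comment> \<open>Terms with \<open>t < T\<close> vanish and the coefficient at
    \<open>t = T\<close> is 1, so the moment collapses to the total mass.\<close>
  have "moment T p ?w = (\<Sum>t\<in>{1..T}. ?w t)"
    unfolding moment_def
  proof (rule sum.cong)
    fix t assume "t \<in> {1..T}"
    with zero show "?w t * real (T - t + 1) powr p = ?w t"
      by (cases "t = T") auto
  qed simp
  with mem show ?thesis by (simp add: weight_simplex_def)
qed

text \<open>The factor \<open>a\<^sub>2\<close> makes the last assumption vacuous for the uniform weights,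
  whose moment may differ from that of \<open>v\<close>.\<close>

lemma sum_squares_hinge_le:
  assumes w: "w \<in> weight_simplex T" and v: "v \<in> weight_simplex T"
    and hinge: "\<And>t. t \<in> {1..T} \<Longrightarrow> w t = pos_part (a\<^sub>1 - a\<^sub>2 * real (T - t + 1) powr p)"
    and moments: "a\<^sub>2 * moment T p v \<le> a\<^sub>2 * moment T p w"
  shows "(\<Sum>t=1..T. (w t)\<^sup>2) \<le> (\<Sum>t=1..T. (v t)\<^sup>2)"
proof -
  let ?c = "\<lambda>t. real (T - t + 1) powr p"
  \<comment> \<open>Complementarity: where the affine expression is nonnegative it equals
    \<open>w t\<close>; where it is negative, \<open>w t = 0\<close> and \<open>v t - w t\<close> is
    nonnegative.\<close>
  have slope: "(a\<^sub>1 - a\<^sub>2 * ?c t) * (v t - w t) \<le> w t * (v t - w t)" if t: "t \<in> {1..T}" for t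
  proof (cases "0 \<le> a\<^sub>1 - a\<^sub>2 * ?c t")
    case True
    with hinge[OF t] show ?thesis by (simp add: pos_part_def)
  next
    case False
    with hinge[OF t] have "w t = 0" by (simp add: pos_part_def)
    with False v t show ?thesis
      by (simp add: weight_simplex_def mult_nonpos_nonneg)
  qed
  have "(\<Sum>t=1..T. (a\<^sub>1 - a\<^sub>2 * ?c t) * (v t - w t)) =
      a\<^sub>1 * ((\<Sum>t=1..T. v t) - (\<Sum>t=1..T. w t)) - a\<^sub>2 * (moment T p v - moment T p w)"
    unfolding moment_def sum_subtractf[symmetric] sum_distrib_left
    by (intro sum.cong) (auto simp: algebra_simps)
  \<comment> \<open>Both total masses are 1, so the \<open>a\<^sub>1\<close> term cancels, and
    \<open>moments\<close> gives the sign of the rest.\<close>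
  also have "\<dots> \<ge> 0"
    using w v moments by (simp add: weight_simplex_def algebra_simps)
  also have "(\<Sum>t=1..T. (a\<^sub>1 - a\<^sub>2 * ?c t) * (v t - w t)) \<le> (\<Sum>t=1..T. w t * (v t - w t))"
    by (rule sum_mono) (rule slope)
  finally have "0 \<le> (\<Sum>t=1..T. w t * (v t - w t))" .
  \<comment> \<open>Tangent-line bound for the square at \<open>w t\<close>; its linear part has a
    nonnegative sum by the inequality just obtained.\<close>
  moreover have "(\<Sum>t=1..T. (w t)\<^sup>2 + 2 * (w t * (v t - w t))) \<le> (\<Sum>t=1..T. (v t)\<^sup>2)"
  proof (rule sum_mono)
    fix t
    have "0 \<le> (v t - w t)\<^sup>2" by simp
    then show "(w t)\<^sup>2 + 2 * (w t * (v t - w t)) \<le> (v t)\<^sup>2"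
      by (simp add: power2_eq_square algebra_simps)
  qed
  ultimately show ?thesis
    by (simp add: sum.distrib sum_distrib_left[symmetric])
qed

lemma objective_mono:
  assumes "0 \<le> p" "0 \<le> \<rho>" and w: "w \<in> weight_simplex T"
    and squares: "(\<Sum>t=1..T. (w t)\<^sup>2) \<le> (\<Sum>t=1..T. (v t)\<^sup>2)"
    and moments: "moment T p w \<le> moment T p v"
  shows "objective T p \<epsilon> \<rho> v \<le> objective T p \<epsilon> \<rho> w"
  unfolding objective_def
proof (rule mult_mono)
  show "N_eff T v \<le> N_eff T w"
    unfolding N_eff_def using squares sum_squares_pos[OF w] by (intro divide_left_mono) auto
  have "D_p T p w \<le> D_p T p v"
    unfolding D_p_eq_moment using assms moment_nonneg[OF w] by (intro powr_mono2) auto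
  then have "pos_part (\<epsilon> - D_p T p v * \<rho>) \<le> pos_part (\<epsilon> - D_p T p w * \<rho>)"
    using assms by (intro pos_part_mono diff_left_mono mult_right_mono)
  then show "pos_part (\<epsilon> - D_p T p v * \<rho>) powr (2 * p) \<le> pos_part (\<epsilon> - D_p T p w * \<rho>) powr (2 * p)"
    using assms by (intro powr_mono2) auto
  show "0 \<le> N_eff T w"
    using sum_squares_pos[OF w] by (simp add: N_eff_def)
qed simp

lemma hinge_weight_dominates:
  assumes "1 \<le> T" "1 \<le> p" "0 \<le> \<rho>" and v: "v \<in> weight_simplex T"
  obtains \<mu> where "\<mu> \<in> {0..1/2}" "objective T p \<epsilon> \<rho> v \<le> objective T p \<epsilon> \<rho> (hinge_weight T p \<mu>)"
proof -
  let ?m = "\<lambda>\<mu>. moment T p (hinge_weight T p \<mu>)"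
  \<comment> \<open>The factor \<open>\<mu>\<close> in the last condition unites two cases: it is
    trivial at \<open>\<mu> = 0\<close>, and otherwise the moments agree.\<close>
  obtain \<mu> where \<mu>: "\<mu> \<in> {0..1/2}" "?m \<mu> \<le> moment T p v" "\<mu> * moment T p v \<le> \<mu> * ?m \<mu>"
  proof (cases "?m 0 \<le> moment T p v")
    case True
    then show thesis using that[of 0] by simp
  next
    case False
    moreover have "?m (1/2) \<le> moment T p v"
      using moment_ge_1[OF _ v] moment_hinge_weight_half[of T p] assms by simp
    ultimately obtain \<mu> where "0 \<le> \<mu>" "\<mu> \<le> 1/2" "?m \<mu> = moment T p v"
      using IVT2'[of ?m "1/2" "moment T p v" 0] continuous_on_moment_hinge_weight[of T p] assms
      by auto
    then show thesis using that[of \<mu>] by simp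
  qed
  have half: "\<mu> \<le> 1/2" using \<mu> by simp
  have mem: "hinge_weight T p \<mu> \<in> weight_simplex T"
    by (rule hinge_weight_in_simplex[OF assms(1) half])
  have "(\<Sum>t=1..T. (hinge_weight T p \<mu> t)\<^sup>2) \<le> (\<Sum>t=1..T. (v t)\<^sup>2)"
  proof (rule sum_squares_hinge_le[OF mem v])
    show "\<mu> / hinge_sum T p \<mu> * moment T p v \<le> \<mu> / hinge_sum T p \<mu> * ?m \<mu>"
      using divide_right_mono[OF \<mu>(3), of "hinge_sum T p \<mu>"] hinge_sum_pos[OF assms(1) half, of p]
      by simp
  qed (rule hinge_weight_eq_pos_part[OF assms(1) half])
  with \<mu> mem assms have "objective T p \<epsilon> \<rho> v \<le> objective T p \<epsilon> \<rho> (hinge_weight T p \<mu>)"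
    by (intro objective_mono) auto
  with \<mu>(1) show thesis by (rule that)
qed

theorem theorem2:
  fixes T :: nat and p \<epsilon> \<rho> :: real
  assumes "1 \<le> T" and "1 \<le> p" and "0 \<le> \<epsilon>" and "0 \<le> \<rho>"
  shows "\<exists>w. is_arg_max (objective T p \<epsilon> \<rho>) (\<lambda>v. v \<in> weight_simplex T) w \<and>
    (\<exists>a\<^sub>1 a\<^sub>2. 0 \<le> a\<^sub>1 \<and> 0 \<le> a\<^sub>2 \<and>
      (\<forall>t\<in>{1..T}. w t = pos_part (a\<^sub>1 - a\<^sub>2 * real (T - t + 1) powr p)))"
proof -
  let ?F = "\<lambda>\<mu>. objective T p \<epsilon> \<rho> (hinge_weight T p \<mu>)"
  obtain \<mu> where \<mu>: "\<mu> \<in> {0..1/2}" and max: "\<And>\<nu>. \<nu> \<in> {0..1/2} \<Longrightarrow> ?F \<nu> \<le> ?F \<mu>"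
    using continuous_attains_sup[OF _ _ continuous_on_objective_hinge_weight[OF assms(1,2)]]
    by (metis atLeastatMost_empty_iff2 compact_Icc half_gt_zero_iff less_eq_real_def
        not_less zero_less_one)
  have half: "\<mu> \<le> 1/2" using \<mu> by simp
  let ?w = "hinge_weight T p \<mu>"
  have "\<not> objective T p \<epsilon> \<rho> ?w < objective T p \<epsilon> \<rho> v" if v: "v \<in> weight_simplex T" for v
  proof -
    obtain \<nu> where "\<nu> \<in> {0..1/2}" "objective T p \<epsilon> \<rho> v \<le> ?F \<nu>"
      using hinge_weight_dominates[OF assms(1,2,4) v] by blast
    with max[of \<nu>] show ?thesis by linarith
  qed
  then have "is_arg_max (objective T p \<epsilon> \<rho>) (\<lambda>v. v \<in> weight_simplex T) ?w"
    using hinge_weight_in_simplex[OF assms(1) half] by (auto simp: is_arg_max_def)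
  \<comment> \<open>These two quotients are the witnesses for \<open>a\<^sub>1\<close> and
    \<open>a\<^sub>2\<close>.\<close>
  moreover have "0 \<le> 1 / hinge_sum T p \<mu>" "0 \<le> \<mu> / hinge_sum T p \<mu>"
    using \<mu> hinge_sum_pos[OF assms(1) half, of p] by auto
  ultimately show ?thesis
    using hinge_weight_eq_pos_part[OF assms(1) half, of _ p] by blast
qed

end
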